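(* Let $K$ be a knot of length $L$ given by an $L$-periodic arc length parametrization $\mathbf r:\mathbb R\to\mathbb R^3$ of class $C^4$ (injective on $[0,L)$), with nowhere vanishing curvature $k$, torsion $\tau$, and Frenet frame $\{\mathbf t,\mathbf n_1,\mathbf n_2\}$. Let $\mathbf z:\mathbb R\to\mathbb R^3$ be an $L$-periodic infinitesimal bending field of $K$ of class $C^4$, i.e. $\mathbf r'(s)\cdot\mathbf z'(s)=0$ for all $s$, and write $\mathbf z=z\,\mathbf t+z_1\mathbf n_1+z_2\mathbf n_2$. Then the first variation of the Willmore energy of $K$ under the infinitesimal bending $\mathbf r_\epsilon=\mathbf r+\epsilon\mathbf z$ is $$\delta\mathcal W=\int_0^L\Big[\big(k''+\tfrac12k^3-k\tau^2\big)z_1+\big(2k'\tau+k\tau'\big)z_2\Big]\,ds .$$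
   Context: Primes denote derivatives with respect to the arc length $s$ of $K$. The Frenet frame consists of the unit tangent $\mathbf t=\mathbf r'$, the unit principal normal $\mathbf n_1$ and the binormal $\mathbf n_2=\mathbf t\times\mathbf n_1$, with $\mathbf t'=k\mathbf n_1$, $\mathbf n_1'=-k\mathbf t+\tau\mathbf n_2$, $\mathbf n_2'=-\tau\mathbf n_1$. An infinitesimal bending of a curve $\mathbf r$ is a family $\mathbf r_\epsilon=\mathbf r+\epsilon\mathbf z$, $\epsilon\ge0$, $\epsilon\to0$, with $ds_\epsilon^2-ds^2=o(\epsilon)$, equivalently $d\mathbf r\cdot d\mathbf z=0$; $\mathbf z$ is called the infinitesimal bending field. The Willmore energy of $K$ is $\mathcal W=\frac12\int_0^L k^2\,ds$, and that of the deformed closed curve $\mathbf r_\epsilon$ is $\mathcal W_\epsilon=\frac12\int_0^L k_\epsilon^2\,ds_\epsilon$, where $k_\epsilon$ is the curvature of $\mathbf r_\epsilon$ and $ds_\epsilon=\|\mathbf r_\epsilon'(s)\|\,ds$ its line element. The first variation is $\delta\mathcal W=\frac{d}{d\epsilon}\mathcal W_\epsilon\big|_{\epsilon=0}$. *)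

theory Defs
  imports "HOL-Analysis.Analysis"
begin

definition vderiv :: "(real \<Rightarrow> 'a::real_normed_vector) \<Rightarrow> real \<Rightarrow> 'a"
  where "vderiv f s = vector_derivative f (at s)"

definition C_k :: "nat \<Rightarrow> (real \<Rightarrow> 'a::real_normed_vector) \<Rightarrow> bool"
  where "C_k n f \<longleftrightarrow>
    (\<forall>j<n. (vderiv ^^ j) f differentiable_on UNIV) \<and> continuous_on UNIV ((vderiv ^^ n) f)"

text \<open>
  The following notions are stated for a regular curve in an arbitrary parametrization, since the
  deformed curves need not have unit speed. Derivatives with respect to arc length are
  derivatives with respect to the parameter divided by the speed \<^term>\<open>norm (vderiv \<gamma> s)\<close>;
  \<^term>\<open>sgn v\<close> is \<^term>\<open>v /\<^sub>R norm v\<close>.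
\<close>

definition unit_tangent :: "(real \<Rightarrow> real^3) \<Rightarrow> real \<Rightarrow> real^3"
  where "unit_tangent \<gamma> s = sgn (vderiv \<gamma> s)"

definition curvature :: "(real \<Rightarrow> real^3) \<Rightarrow> real \<Rightarrow> real"
  where "curvature \<gamma> s = norm (vderiv (unit_tangent \<gamma>) s) / norm (vderiv \<gamma> s)"

definition principal_normal :: "(real \<Rightarrow> real^3) \<Rightarrow> real \<Rightarrow> real^3"
  where "principal_normal \<gamma> s = sgn (vderiv (unit_tangent \<gamma>) s)"

definition binormal :: "(real \<Rightarrow> real^3) \<Rightarrow> real \<Rightarrow> real^3"
  where "binormal \<gamma> s = cross3 (unit_tangent \<gamma> s) (principal_normal \<gamma> s)"

text \<open>The sign convention is that of \<open>n\<^sub>1' = - k t + \<tau> n\<^sub>2\<close>.\<close>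

definition torsion :: "(real \<Rightarrow> real^3) \<Rightarrow> real \<Rightarrow> real"
  where "torsion \<gamma> s =
    (vderiv (principal_normal \<gamma>) s \<bullet> binormal \<gamma> s) / norm (vderiv \<gamma> s)"

definition infinitesimal_bending_field :: "(real \<Rightarrow> real^3) \<Rightarrow> (real \<Rightarrow> real^3) \<Rightarrow> bool"
  where "infinitesimal_bending_field r z \<longleftrightarrow> (\<forall>s. vderiv r s \<bullet> vderiv z s = 0)"

definition willmore_energy :: "real \<Rightarrow> (real \<Rightarrow> real^3) \<Rightarrow> real"
  where "willmore_energy L \<gamma> =
    1/2 * integral {0..L} (\<lambda>s. (curvature \<gamma> s)\<^sup>2 * norm (vderiv \<gamma> s))"

text \<open>For an arc length parametrization these are the usual formulas.\<close>

lemma unit_speed_tangent: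
  assumes "\<And>s. norm (vderiv r s) = 1"
  shows "unit_tangent r = vderiv r"
  by (simp add: fun_eq_iff unit_tangent_def sgn_div_norm assms)

lemma unit_speed_curvature:
  assumes "\<And>s. norm (vderiv r s) = 1"
  shows "curvature r s = norm (vderiv (vderiv r) s)"
  by (simp add: curvature_def unit_speed_tangent assms)

lemma unit_speed_frenet:
  assumes "\<And>s. norm (vderiv r s) = 1"
  shows "vderiv (unit_tangent r) s = curvature r s *\<^sub>R principal_normal r s"
  by (cases "vderiv (unit_tangent r) s = 0")
     (simp_all add: curvature_def principal_normal_def sgn_div_norm assms)

end

theory Submission
  imports Defs
begin

text \<open>
  The deformed curve has velocity \<open>r' + \<epsilon> z'\<close>. Because \<open>r' \<bullet> z' = 0\<close> and \<open>r\<close> has unit speed, its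
  speed is \<open>sqrt (1 + \<epsilon>\<^sup>2 (z' \<bullet> z'))\<close>, which has no term of first order in \<open>\<epsilon>\<close> and never vanishes.
  Up to \<open>O(\<epsilon>\<^sup>2)\<close> the energy density is therefore the square of the length of the acceleration
  \<open>r'' + \<epsilon> z''\<close>, and \<open>\<delta>W\<close> is the integral of \<open>r'' \<bullet> z''\<close>
  (\<open>first_variation_second_derivatives\<close>). Making this precise takes the exact energy density of a
  regular curve (\<open>bending_energy_density\<close>) and differentiation under the integral sign
  (\<open>derivative_of_bending_energy_integral\<close>).

  Two integrations by parts over a period turn \<open>r'' \<bullet> z''\<close> into \<open>r'''' \<bullet> z\<close>, and the Frenet
  equations give
  \<open>r'''' = - 3 k k' t + (k'' - k\<^sup>3 - k \<tau>\<^sup>2) n\<^sub>1 + (2 k' \<tau> + k \<tau>') n\<^sub>2\<close> (\<open>fourth_derivative_frenet\<close>).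
  The tangential term is removed by the bending condition: if \<open>z\<^sub>t = z \<bullet> t\<close>, then
  \<open>z\<^sub>t' = z' \<bullet> t + z \<bullet> t' = k z\<^sub>1\<close>, so a third integration by parts replaces
  \<open>- 3 k k' z\<^sub>t = - (3/2) (k\<^sup>2)' z\<^sub>t\<close> by \<open>(3/2) k\<^sup>3 z\<^sub>1\<close>, and
  \<open>- k\<^sup>3 + (3/2) k\<^sup>3 = k\<^sup>3 / 2\<close>. All three integrations by parts are carried out at once by exhibiting
  a periodic antiderivative of the difference of the two integrands.
\<close>

section \<open>Derivatives of vector-valued functions\<close>

lemma C_k_has_vector_derivative:
  assumes "C_k n f" "j < n"
  shows "((vderiv ^^ j) f has_vector_derivative (vderiv ^^ Suc j) f s) (at s)"
  using assms
  by (simp add: C_k_def vderiv_def differentiable_on_def vector_derivative_works[symmetric])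

lemma C_k_continuous:
  assumes "C_k n f" "j \<le> n"
  shows "continuous_on A ((vderiv ^^ j) f)"
proof -
  have "continuous_on UNIV ((vderiv ^^ j) f)"
    using assms by (cases "j = n") (auto simp: C_k_def intro: differentiable_imp_continuous_on)
  then show ?thesis
    using continuous_on_subset by blast
qed

lemma C_k_mono:
  assumes "C_k n f" "m \<le> n"
  shows "C_k m f"
  using assms C_k_continuous[OF assms] by (auto simp: C_k_def)

lemma C_k_has_vector_derivatives:
  assumes "C_k n f"
  shows "0 < n \<Longrightarrow> (f has_vector_derivative vderiv f s) (at s)"
    and "1 < n \<Longrightarrow> (vderiv f has_vector_derivative vderiv (vderiv f) s) (at s)"
    and "2 < n \<Longrightarrow>
      (vderiv (vderiv f) has_vector_derivative vderiv (vderiv (vderiv f)) s) (at s)"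
    and "3 < n \<Longrightarrow>
      (vderiv (vderiv (vderiv f)) has_vector_derivative vderiv (vderiv (vderiv (vderiv f))) s) (at s)"
  using C_k_has_vector_derivative[OF assms, of 0 s] C_k_has_vector_derivative[OF assms, of 1 s]
    C_k_has_vector_derivative[OF assms, of 2 s] C_k_has_vector_derivative[OF assms, of 3 s]
  by (simp_all add: eval_nat_numeral)

lemma vderiv_eqI: "(f has_vector_derivative f') (at s) \<Longrightarrow> vderiv f s = f'"
  by (simp add: vderiv_def vector_derivative_at)

lemma vderiv_periodic:
  assumes "\<And>s. (f has_vector_derivative vderiv f s) (at s)" "\<And>s. f (s + L) = f s"
  shows "vderiv f (s + L) = vderiv f s"
proof -
  have "((f \<circ> (\<lambda>s. s + L)) has_vector_derivative 1 *\<^sub>R vderiv f (s + L)) (at s)"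
    by (rule vector_diff_chain_at) (auto intro!: derivative_eq_intros assms)
  moreover have "f \<circ> (\<lambda>s. s + L) = f"
    using assms(2) by auto
  ultimately show ?thesis
    by (simp add: vderiv_eqI)
qed

lemma has_real_derivative_inner:
  fixes f g :: "real \<Rightarrow> 'a::real_inner"
  assumes "(f has_vector_derivative f') (at s)" "(g has_vector_derivative g') (at s)"
  shows "((\<lambda>s. f s \<bullet> g s) has_real_derivative f s \<bullet> g' + f' \<bullet> g s) (at s)"
  using bounded_bilinear.has_vector_derivative[OF bounded_bilinear_inner assms]
  by (simp add: has_real_derivative_iff_has_vector_derivative)

lemma derivative_of_constant_inner:
  fixes f g :: "real \<Rightarrow> 'a::real_inner"
  assumes "(f has_vector_derivative f') (at s)" "(g has_vector_derivative g') (at s)"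
    and "\<And>s. f s \<bullet> g s = c"
  shows "f s \<bullet> g' + f' \<bullet> g s = 0"
  using has_real_derivative_inner[OF assms(1,2)] DERIV_unique[OF _ DERIV_const]
  by (auto simp: assms(3))

lemma has_vector_derivative_cross3:
  assumes "(f has_vector_derivative f') (at s)" "(g has_vector_derivative g') (at s)"
  shows "((\<lambda>s. cross3 (f s) (g s)) has_vector_derivative cross3 (f s) g' + cross3 f' (g s)) (at s)"
  by (rule bounded_bilinear.has_vector_derivative
        [OF bilinear_cross[unfolded bilinear_conv_bounded_bilinear] assms])

lemma has_real_derivative_norm:
  fixes f :: "real \<Rightarrow> 'a::real_inner"
  assumes "(f has_vector_derivative f') (at s)" "f s \<noteq> 0"
  shows "((\<lambda>s. norm (f s)) has_real_derivative (f s \<bullet> f') / norm (f s)) (at s)"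
proof -
  have "((\<lambda>s. sqrt (f s \<bullet> f s)) has_real_derivative
          (f s \<bullet> f' + f' \<bullet> f s) * (inverse (sqrt (f s \<bullet> f s)) / 2)) (at s)"
    using DERIV_chain2[OF DERIV_real_sqrt has_real_derivative_inner[OF assms(1) assms(1)]] assms(2)
    by (simp add: mult.commute)
  then show ?thesis
    by (simp add: norm_eq_sqrt_inner inner_commute field_simps)
qed

lemma has_vector_derivative_sgn:
  fixes f :: "real \<Rightarrow> 'a::real_inner"
  assumes "(f has_vector_derivative f') (at s)" "f s \<noteq> 0"
  shows "((\<lambda>s. sgn (f s)) has_vector_derivative
           (1 / norm (f s)) *\<^sub>R f' - ((f s \<bullet> f') / norm (f s) ^ 3) *\<^sub>R f s) (at s)"
proof -
  have "((\<lambda>s. inverse (norm (f s))) has_real_derivative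
          - ((f s \<bullet> f') / norm (f s) ^ 3)) (at s)"
    using DERIV_inverse_fun[OF has_real_derivative_norm[OF assms]] assms(2)
    by (simp add: power3_eq_cube divide_simps mult.assoc)
  from has_vector_derivative_scaleR[OF this assms(1)]
  show ?thesis
    by (simp add: sgn_div_norm inverse_eq_divide)
qed

section \<open>The energy density and its first variation\<close>

text \<open>
  The derivative of \<open>v / |v|\<close> is the component of \<open>a\<close> normal to \<open>v\<close>, divided by \<open>|v|\<close>, and its
  squared length is \<open>(a \<bullet> a) / |v|\<^sup>2 - (v \<bullet> a)\<^sup>2 / |v|\<^sup>4\<close>. One division by the speed remains: two come
  from the square of the curvature, and the line element cancels one of them.
\<close>

lemma bending_energy_density:
  assumes "\<And>s. (\<gamma> has_vector_derivative v s) (at s)"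
    and "(v has_vector_derivative a) (at s)"
    and "\<And>s. v s \<noteq> 0"
  shows "(curvature \<gamma> s)\<^sup>2 * norm (vderiv \<gamma> s) =
           (a \<bullet> a) / norm (v s) ^ 3 - (v s \<bullet> a)\<^sup>2 / norm (v s) ^ 5"
proof -
  have v: "vderiv \<gamma> = v"
    using assms(1) by (auto simp: vderiv_eqI)
  define n where "n = norm (v s)"
  have n: "n > 0" "v s \<bullet> v s = n\<^sup>2"
    using assms(3) by (auto simp: n_def power2_norm_eq_inner)
  have T: "vderiv (unit_tangent \<gamma>) s = (1 / n) *\<^sub>R a - ((v s \<bullet> a) / n ^ 3) *\<^sub>R v s"
    using vderiv_eqI[OF has_vector_derivative_sgn[OF assms(2,3)]]
    by (simp add: unit_tangent_def[abs_def] v n_def)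
  have "(norm (vderiv (unit_tangent \<gamma>) s))\<^sup>2 = (a \<bullet> a) / n\<^sup>2 - (v s \<bullet> a)\<^sup>2 / n ^ 4"
    using n unfolding T power2_norm_eq_inner
    by (simp add: inner_diff_left inner_diff_right inner_commute field_simps eval_nat_numeral)
  then show ?thesis
    using n unfolding curvature_def v n_def[symmetric]
    by (simp add: power_divide field_simps eval_nat_numeral)
qed

text \<open>
  This is applied to \<open>c = z' \<bullet> z'\<close>, \<open>q = z' \<bullet> z''\<close> and to the coefficients \<open>p0\<close>, \<open>2 p1\<close>, \<open>p2\<close> of
  \<open>|r'' + \<epsilon> z''|\<^sup>2\<close> as a polynomial in \<open>\<epsilon>\<close>; the integrand is then the energy density of
  \<open>r + \<epsilon> z\<close>. Since \<open>c\<close> and \<open>q\<close> enter only with \<open>\<epsilon>\<^sup>2\<close> and \<open>\<epsilon>\<^sup>4\<close>, they leave no trace in the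
  derivative at \<open>0\<close>.
\<close>

lemma derivative_of_bending_energy_integral:
  fixes p0 p1 p2 q c :: "real \<Rightarrow> real"
  assumes cont: "continuous_on {a..b} p0" "continuous_on {a..b} p1" "continuous_on {a..b} p2"
      "continuous_on {a..b} q" "continuous_on {a..b} c"
    and c: "\<And>s. c s \<ge> 0"
  shows "((\<lambda>\<epsilon>. integral {a..b} (\<lambda>s.
             (p0 s + 2 * \<epsilon> * p1 s + \<epsilon>\<^sup>2 * p2 s) / sqrt (1 + \<epsilon>\<^sup>2 * c s) ^ 3
             - (\<epsilon>\<^sup>2 * q s)\<^sup>2 / sqrt (1 + \<epsilon>\<^sup>2 * c s) ^ 5))
          has_real_derivative integral {a..b} (\<lambda>s. 2 * p1 s)) (at 0)"
proof -
  let ?w = "\<lambda>\<epsilon> s. sqrt (1 + \<epsilon>\<^sup>2 * c s)"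
  define F where "F \<epsilon> s = (p0 s + 2 * \<epsilon> * p1 s + \<epsilon>\<^sup>2 * p2 s) / ?w \<epsilon> s ^ 3
             - (\<epsilon>\<^sup>2 * q s)\<^sup>2 / ?w \<epsilon> s ^ 5" for \<epsilon> s
  \<comment> \<open>The derivative of the square root \<open>w\<close> is \<open>\<epsilon> c / w\<close>, so each differentiated power of \<open>w\<close>
    in a denominator raises its exponent by two.\<close>
  define F' where "F' \<epsilon> s = (2 * p1 s + 2 * \<epsilon> * p2 s) / ?w \<epsilon> s ^ 3
      - 3 * (p0 s + 2 * \<epsilon> * p1 s + \<epsilon>\<^sup>2 * p2 s) * (\<epsilon> * c s) / ?w \<epsilon> s ^ 5
      - 4 * \<epsilon> ^ 3 * (q s)\<^sup>2 / ?w \<epsilon> s ^ 5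
      + 5 * (\<epsilon>\<^sup>2 * q s)\<^sup>2 * (\<epsilon> * c s) / ?w \<epsilon> s ^ 7" for \<epsilon> s
  have pos: "1 + \<epsilon>\<^sup>2 * c s > 0" for \<epsilon> s
    using c[of s] by (simp add: add_pos_nonneg)
  then have wnz: "?w \<epsilon> s > 0" for \<epsilon> s by simp
  have w': "((\<lambda>\<epsilon>. ?w \<epsilon> s) has_real_derivative \<epsilon> * c s / ?w \<epsilon> s) (at \<epsilon>)" for \<epsilon> s
    using pos[of \<epsilon> s] by (auto intro!: derivative_eq_intros simp: field_simps)
  have cont': "continuous_on (UNIV \<times> {a..b}) (\<lambda>x. p (snd x))"
    if "continuous_on {a..b} p" for p :: "real \<Rightarrow> real"
    by (rule continuous_on_compose2[OF that]) (auto intro!: continuous_intros)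
  have "((\<lambda>\<epsilon>. integral (cbox a b) (F \<epsilon>)) has_real_derivative integral (cbox a b) (F' 0))
          (at 0 within UNIV)"
  proof (rule leibniz_rule_field_derivative)
    show "((\<lambda>\<epsilon>. F \<epsilon> s) has_real_derivative F' \<epsilon> s) (at \<epsilon> within UNIV)" for \<epsilon> s
    proof -
      have w3: "((\<lambda>\<epsilon>. ?w \<epsilon> s ^ 3) has_real_derivative 3 * ?w \<epsilon> s * (\<epsilon> * c s)) (at \<epsilon>)"
        using DERIV_power[OF w'[of s \<epsilon>], of 3] wnz[of \<epsilon> s]
        by (simp add: power2_eq_square mult_ac del: real_sqrt_pow2 real_sqrt_mult_self)
      have w5: "((\<lambda>\<epsilon>. ?w \<epsilon> s ^ 5) has_real_derivative 5 * ?w \<epsilon> s ^ 3 * (\<epsilon> * c s)) (at \<epsilon>)"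
        using DERIV_power[OF w'[of s \<epsilon>], of 5] wnz[of \<epsilon> s]
        by (simp add: eval_nat_numeral mult_ac del: real_sqrt_pow2 real_sqrt_mult_self)
      have P: "((\<lambda>\<epsilon>. p0 s + 2 * \<epsilon> * p1 s + \<epsilon>\<^sup>2 * p2 s) has_real_derivative
                 2 * p1 s + 2 * \<epsilon> * p2 s) (at \<epsilon>)"
        by (auto intro!: derivative_eq_intros)
      have Q: "((\<lambda>\<epsilon>. (\<epsilon>\<^sup>2 * q s)\<^sup>2) has_real_derivative 4 * \<epsilon> ^ 3 * (q s)\<^sup>2) (at \<epsilon>)"
        by (auto intro!: derivative_eq_intros simp: eval_nat_numeral)
      have quot3: "(A * w ^ 3 - B * (3 * w * e)) / (w ^ 3 * w ^ 3) = A / w ^ 3 - 3 * B * e / w ^ 5"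
        and quot5: "(A * w ^ 5 - B * (5 * w ^ 3 * e)) / (w ^ 5 * w ^ 5)
                      = A / w ^ 5 - 5 * B * e / w ^ 7"
        if "w > 0" for A B e w :: real
        using that by (simp_all add: divide_simps eval_nat_numeral) (simp_all add: algebra_simps)
      have "((\<lambda>\<epsilon>. F \<epsilon> s) has_real_derivative
          ((2 * p1 s + 2 * \<epsilon> * p2 s) / ?w \<epsilon> s ^ 3
            - 3 * (p0 s + 2 * \<epsilon> * p1 s + \<epsilon>\<^sup>2 * p2 s) * (\<epsilon> * c s) / ?w \<epsilon> s ^ 5)
          - (4 * \<epsilon> ^ 3 * (q s)\<^sup>2 / ?w \<epsilon> s ^ 5
            - 5 * (\<epsilon>\<^sup>2 * q s)\<^sup>2 * (\<epsilon> * c s) / ?w \<epsilon> s ^ 7)) (at \<epsilon>)"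
        unfolding F_def
        by (rule DERIV_diff[OF DERIV_divide[OF P w3, unfolded quot3[OF wnz]]
              DERIV_divide[OF Q w5, unfolded quot5[OF wnz]]])
          (use wnz[of \<epsilon> s] in simp_all)
      then show ?thesis
        by (simp add: F'_def algebra_simps)
    qed
    show "F \<epsilon> integrable_on cbox a b" for \<epsilon>
      unfolding F_def
      by (rule integrable_continuous)
        (use wnz pos in \<open>auto intro!: continuous_intros cont simp: less_imp_neq[symmetric]\<close>)
    show "continuous_on (UNIV \<times> cbox a b) (\<lambda>(\<epsilon>, s). F' \<epsilon> s)"
      unfolding F'_def split_def
      using wnz pos by (auto intro!: continuous_intros cont' cont simp: less_imp_neq[symmetric])
  qed auto
  then show ?thesis
    by (simp add: F_def[abs_def] F'_def[abs_def])
qed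

text \<open>
  Differentiating \<open>r' \<bullet> r' = 1\<close> and \<open>r' \<bullet> z' = 0\<close> shows that
  \<open>(r' + \<epsilon> z') \<bullet> (r'' + \<epsilon> z'')\<close> reduces to \<open>\<epsilon>\<^sup>2 (z' \<bullet> z'')\<close>, so the square
  of this inner product contributes to the energy density only at order \<open>\<epsilon>\<^sup>4\<close>.
\<close>

lemma first_variation_second_derivatives:
  fixes r z :: "real \<Rightarrow> real^3"
  assumes r: "C_k 2 r" and z: "C_k 2 z"
    and unit: "\<And>s. norm (vderiv r s) = 1"
    and bend: "infinitesimal_bending_field r z"
  shows "((\<lambda>\<epsilon>. willmore_energy L (\<lambda>s. r s + \<epsilon> *\<^sub>R z s)) has_real_derivative
           integral {0..L} (\<lambda>s. vderiv (vderiv r) s \<bullet> vderiv (vderiv z) s)) (at 0)"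
proof -
  let ?r1 = "vderiv r" and ?r2 = "vderiv (vderiv r)"
  let ?z1 = "vderiv z" and ?z2 = "vderiv (vderiv z)"
  note dr = C_k_has_vector_derivatives[OF r, simplified]
    and dz = C_k_has_vector_derivatives[OF z, simplified]
  have rz: "?r1 s \<bullet> ?z1 s = 0" for s
    using bend by (simp add: infinitesimal_bending_field_def)
  have rr: "?r1 s \<bullet> ?r1 s = 1" for s
    using unit[of s] by (simp add: dot_square_norm)
  have r12: "?r1 s \<bullet> ?r2 s = 0" for s
    using derivative_of_constant_inner[OF dr(2) dr(2) rr, of s] by (simp add: inner_commute)
  have rz2: "?r1 s \<bullet> ?z2 s + ?r2 s \<bullet> ?z1 s = 0" for s
    by (rule derivative_of_constant_inner[OF dr(2) dz(2) rz])
  have speed: "norm (?r1 s + \<epsilon> *\<^sub>R ?z1 s) = sqrt (1 + \<epsilon>\<^sup>2 * (?z1 s \<bullet> ?z1 s))" for \<epsilon> s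
    using rr rz by (simp add: norm_eq_sqrt_inner inner_add_left inner_add_right inner_commute[of "?z1 s" "?r1 s"]
        power2_eq_square)
  have energy: "willmore_energy L (\<lambda>s. r s + \<epsilon> *\<^sub>R z s) = 1/2 * integral {0..L} (\<lambda>s.
          (?r2 s \<bullet> ?r2 s + 2 * \<epsilon> * (?r2 s \<bullet> ?z2 s) + \<epsilon>\<^sup>2 * (?z2 s \<bullet> ?z2 s))
             / sqrt (1 + \<epsilon>\<^sup>2 * (?z1 s \<bullet> ?z1 s)) ^ 3
          - (\<epsilon>\<^sup>2 * (?z1 s \<bullet> ?z2 s))\<^sup>2 / sqrt (1 + \<epsilon>\<^sup>2 * (?z1 s \<bullet> ?z1 s)) ^ 5)" for \<epsilon>
  proof -
    have "(curvature (\<lambda>s. r s + \<epsilon> *\<^sub>R z s) s)\<^sup>2 * norm (vderiv (\<lambda>s. r s + \<epsilon> *\<^sub>R z s) s) =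
       ((?r2 s + \<epsilon> *\<^sub>R ?z2 s) \<bullet> (?r2 s + \<epsilon> *\<^sub>R ?z2 s)) / norm (?r1 s + \<epsilon> *\<^sub>R ?z1 s) ^ 3
       - ((?r1 s + \<epsilon> *\<^sub>R ?z1 s) \<bullet> (?r2 s + \<epsilon> *\<^sub>R ?z2 s))\<^sup>2 / norm (?r1 s + \<epsilon> *\<^sub>R ?z1 s) ^ 5" for s
    proof (rule bending_energy_density)
      have "0 < 1 + \<epsilon>\<^sup>2 * (?z1 s \<bullet> ?z1 s)" for s
        by (simp add: add_pos_nonneg)
      then have "norm (?r1 s + \<epsilon> *\<^sub>R ?z1 s) > 0" for s
        unfolding speed by simp
      then show "?r1 s + \<epsilon> *\<^sub>R ?z1 s \<noteq> 0" for s
        unfolding zero_less_norm_iff .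
    qed (auto intro!: derivative_eq_intros dr dz)
    moreover have "(?r1 s + \<epsilon> *\<^sub>R ?z1 s) \<bullet> (?r2 s + \<epsilon> *\<^sub>R ?z2 s) = \<epsilon>\<^sup>2 * (?z1 s \<bullet> ?z2 s)" for s
    proof -
      have "(?r1 s + \<epsilon> *\<^sub>R ?z1 s) \<bullet> (?r2 s + \<epsilon> *\<^sub>R ?z2 s)
          = ?r1 s \<bullet> ?r2 s + \<epsilon> * (?r1 s \<bullet> ?z2 s + ?r2 s \<bullet> ?z1 s) + \<epsilon>\<^sup>2 * (?z1 s \<bullet> ?z2 s)"
        by (simp add: inner_add_left inner_add_right inner_commute algebra_simps power2_eq_square)
      then show ?thesis
        by (simp add: r12 rz2)
    qed
    moreover have "(?r2 s + \<epsilon> *\<^sub>R ?z2 s) \<bullet> (?r2 s + \<epsilon> *\<^sub>R ?z2 s)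
        = ?r2 s \<bullet> ?r2 s + 2 * \<epsilon> * (?r2 s \<bullet> ?z2 s) + \<epsilon>\<^sup>2 * (?z2 s \<bullet> ?z2 s)" for s
      by (simp add: inner_add_left inner_add_right inner_commute algebra_simps power2_eq_square)
    ultimately show ?thesis
      unfolding willmore_energy_def by (simp add: speed)
  qed
  have "continuous_on {0..L} ?r2" "continuous_on {0..L} ?z1" "continuous_on {0..L} ?z2"
    using C_k_continuous[OF r, of 2] C_k_continuous[OF z, of 1] C_k_continuous[OF z, of 2]
    by (simp_all add: eval_nat_numeral)
  then show ?thesis
    unfolding energy
    using DERIV_cmult[OF derivative_of_bending_energy_integral, of 0 L "\<lambda>s. ?r2 s \<bullet> ?r2 s" "\<lambda>s. ?r2 s \<bullet> ?z2 s"
        "\<lambda>s. ?z2 s \<bullet> ?z2 s" "\<lambda>s. ?z1 s \<bullet> ?z2 s" "\<lambda>s. ?z1 s \<bullet> ?z1 s" "1/2"]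
    by (simp add: continuous_intros)
qed

section \<open>The Frenet frame and the fourth derivative\<close>

text \<open>
  The remainder \<open>w\<close> after subtracting the three projections is orthogonal to \<open>t\<close> and \<open>n\<close>, so
  \<open>w \<times> (t \<times> n) = 0\<close> by the identity of Lagrange; it is also orthogonal to the nonzero vector
  \<open>t \<times> n\<close>, hence it vanishes.
\<close>

lemma orthonormal_cross3_expansion:
  fixes t n v :: "real^3"
  assumes "t \<bullet> t = 1" "n \<bullet> n = 1" "t \<bullet> n = 0"
  shows "v = (v \<bullet> t) *\<^sub>R t + (v \<bullet> n) *\<^sub>R n + (v \<bullet> cross3 t n) *\<^sub>R cross3 t n"
proof -
  define b where "b = cross3 t n"
  have b: "t \<bullet> b = 0" "n \<bullet> b = 0" "b \<bullet> t = 0" "b \<bullet> n = 0" "b \<bullet> b = 1"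
    using assms unfolding b_def
    by (auto simp: dot_cross_self dot_cross inner_commute)
  define w where "w = v - ((v \<bullet> t) *\<^sub>R t + (v \<bullet> n) *\<^sub>R n + (v \<bullet> b) *\<^sub>R b)"
  have w: "w \<bullet> t = 0" "w \<bullet> n = 0" "w \<bullet> b = 0"
    using assms b by (auto simp: w_def inner_diff_left inner_add_left inner_commute[of n t])
  then have "cross3 w b = 0"
    by (simp add: b_def Lagrange)
  then have "w = 0"
    using w b norm_and_cross_eq_0[of w b] by auto
  then show ?thesis
    by (simp add: w_def b_def)
qed

text \<open>
  Class \<open>C\<^sup>4\<close> is what makes the second derivative of \<open>k\<close> and the first derivative of \<open>\<tau>\<close> exist: \<open>k\<close>
  is the length of the nowhere vanishing \<open>r''\<close>, which can be differentiated twice, and \<open>\<tau> = n' \<bullet> b\<close>,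
  where \<open>n'\<close> is an expression in \<open>r''\<close>, \<open>r'''\<close> and \<open>k\<close>. The coefficients of \<open>n'\<close> in the frame come from
  differentiating \<open>n \<bullet> n = 1\<close> and \<open>t \<bullet> n = 0\<close>; those of \<open>b'\<close> from \<open>b = t \<times> n\<close>.
\<close>

lemma unit_speed_frenet_equations:
  fixes r :: "real \<Rightarrow> real^3"
  assumes r: "C_k 4 r"
    and unit: "\<And>s. norm (vderiv r s) = 1"
    and nz: "\<And>s. curvature r s \<noteq> 0"
  defines "k \<equiv> curvature r" and "\<tau> \<equiv> torsion r"
    and "t \<equiv> unit_tangent r" and "n \<equiv> principal_normal r" and "b \<equiv> binormal r"
  shows "t s \<bullet> t s = 1" "n s \<bullet> n s = 1" "t s \<bullet> n s = 0" "t s \<bullet> b s = 0" "n s \<bullet> b s = 0"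
      "b s \<bullet> b s = 1"
    and "(t has_vector_derivative k s *\<^sub>R n s) (at s)"
    and "(n has_vector_derivative \<tau> s *\<^sub>R b s - k s *\<^sub>R t s) (at s)"
    and "(b has_vector_derivative - (\<tau> s *\<^sub>R n s)) (at s)"
    and "(k has_real_derivative deriv k s) (at s)"
    and "(deriv k has_real_derivative deriv (deriv k) s) (at s)"
    and "(\<tau> has_real_derivative deriv \<tau> s) (at s)"
proof -
  let ?r2 = "vderiv (vderiv r)" and ?r3 = "vderiv (vderiv (vderiv r))"
  note d = C_k_has_vector_derivatives[OF r, simplified]
  have t: "t = vderiv r"
    by (simp add: t_def unit_speed_tangent unit)
  have k: "k = (\<lambda>s. norm (?r2 s))"
    by (simp add: k_def fun_eq_iff unit_speed_curvature unit)
  have knz: "k s \<noteq> 0" and r2nz: "?r2 s \<noteq> 0" for s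
    using nz[of s] by (auto simp: k_def[symmetric]) (simp add: k)
  have n: "n = (\<lambda>s. sgn (?r2 s))"
    using t by (simp add: n_def principal_normal_def[abs_def] t_def)
  have b: "b = (\<lambda>s. cross3 (t s) (n s))"
    by (simp add: b_def binormal_def[abs_def] t_def n_def)
  have kn: "?r2 s = k s *\<^sub>R n s" for s
    using r2nz by (simp add: k n sgn_div_norm)

  have k': "(k has_real_derivative (?r2 s \<bullet> ?r3 s) / k s) (at s)" for s
    using has_real_derivative_norm[OF d(3) r2nz] by (simp add: k)
  then have dk: "deriv k = (\<lambda>s. (?r2 s \<bullet> ?r3 s) / k s)"
    by (auto simp: DERIV_imp_deriv)
  show "(k has_real_derivative deriv k s) (at s)"
    using k' dk by simp
  have "deriv k field_differentiable (at s)" for s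
    unfolding dk field_differentiable_def
    using DERIV_divide[OF has_real_derivative_inner[OF d(3,4)] k' knz] by blast
  then show "(deriv k has_real_derivative deriv (deriv k) s) (at s)"
    by (simp add: DERIV_deriv_iff_field_differentiable)

  have tt: "t s \<bullet> t s = 1" and nn: "n s \<bullet> n s = 1" for s
    using unit[of s] r2nz[of s] by (auto simp: t n dot_square_norm norm_sgn)
  have "t s \<bullet> ?r2 s = 0" for s
    using derivative_of_constant_inner[OF d(2) d(2) tt[unfolded t], of s]
    by (simp add: t inner_commute)
  from this[unfolded kn] have tn: "t s \<bullet> n s = 0" for s
    using knz by simp
  show "t s \<bullet> t s = 1" "n s \<bullet> n s = 1" "t s \<bullet> n s = 0"
    by (fact tt nn tn)+
  show "t s \<bullet> b s = 0" "n s \<bullet> b s = 0" "b s \<bullet> b s = 1"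
    using tt nn tn by (simp_all add: b dot_cross_self dot_cross inner_commute)
  show t': "(t has_vector_derivative k s *\<^sub>R n s) (at s)" for s
    using d(2) by (simp add: t kn)

  \<comment> \<open>The explicit formula for the derivative of \<open>r'' / k\<close> serves to show, at the end, that this
    derivative is itself differentiable.\<close>
  define n' where "n' s = (1 / k s) *\<^sub>R ?r3 s - ((?r2 s \<bullet> ?r3 s) / k s ^ 3) *\<^sub>R ?r2 s" for s
  have n': "(n has_vector_derivative n' s) (at s)" for s
    using has_vector_derivative_sgn[OF d(3) r2nz] by (simp add: n n'_def k)
  have n'n: "n' s \<bullet> n s = 0" for s
    using derivative_of_constant_inner[OF n' n' nn, of s] by (simp add: inner_commute)
  have n't: "n' s \<bullet> t s = - k s" for s
    using derivative_of_constant_inner[OF t' n' tn, of s] by (simp add: nn inner_commute)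
  have tau: "\<tau> = (\<lambda>s. n' s \<bullet> b s)"
    by (simp add: \<tau>_def torsion_def fun_eq_iff unit vderiv_eqI[OF n'] flip: n_def b_def)
  have frame: "n' s = \<tau> s *\<^sub>R b s - k s *\<^sub>R t s" for s
    using orthonormal_cross3_expansion[OF tt nn tn, of "n' s" s]
    by (simp add: n'n n't tau b)
  show "(n has_vector_derivative \<tau> s *\<^sub>R b s - k s *\<^sub>R t s) (at s)"
    using n' by (simp add: frame)
  have "(b has_vector_derivative cross3 (t s) (n' s) + cross3 (k s *\<^sub>R n s) (n s)) (at s)" for s
    unfolding b by (intro has_vector_derivative_cross3 n' t')
  moreover have "cross3 (t s) (n' s) + cross3 (k s *\<^sub>R n s) (n s) = - (\<tau> s *\<^sub>R n s)" for s
    by (simp add: frame b cross_mult_left cross_mult_right Cross3.right_diff_distrib Lagrange tt tn)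
  ultimately show b': "(b has_vector_derivative - (\<tau> s *\<^sub>R n s)) (at s)" for s
    by simp

  have "\<exists>n''. (n' has_vector_derivative n'') (at s)" for s
  proof -
    have c1: "((\<lambda>s. 1 / k s) has_real_derivative - (deriv k s / (k s)\<^sup>2)) (at s)"
      using DERIV_inverse_fun[OF k' knz] by (simp add: dk inverse_eq_divide divide_simps power2_eq_square)
    have c2: "((\<lambda>s. (?r2 s \<bullet> ?r3 s) / k s ^ 3) has_real_derivative
        ((?r2 s \<bullet> vderiv ?r3 s + ?r3 s \<bullet> ?r3 s) * k s ^ 3
          - (?r2 s \<bullet> ?r3 s) * (of_nat 3 * (deriv k s * k s ^ (3 - Suc 0)))) / (k s ^ 3 * k s ^ 3)) (at s)"
      using knz k' by (intro DERIV_divide has_real_derivative_inner d DERIV_power) (auto simp: dk)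
    show ?thesis
      using has_vector_derivative_diff
        [OF has_vector_derivative_scaleR[OF c1 d(4)] has_vector_derivative_scaleR[OF c2 d(3)]]
      unfolding n'_def by blast
  qed
  then obtain n'' where "(n' has_vector_derivative n'') (at s)"
    by blast
  from has_real_derivative_inner[OF this b']
  show "(\<tau> has_real_derivative deriv \<tau> s) (at s)"
    unfolding tau by (auto simp: DERIV_deriv_iff_real_differentiable real_differentiable_def)
qed

text \<open>
  Differentiate \<open>r'' = k n\<close> twice, replacing derivatives of the frame by the Frenet equations.
\<close>

lemma fourth_derivative_frenet:
  fixes r :: "real \<Rightarrow> real^3"
  assumes r: "C_k 4 r"
    and unit: "\<And>s. norm (vderiv r s) = 1"
    and nz: "\<And>s. curvature r s \<noteq> 0"
  defines "k \<equiv> curvature r" and "\<tau> \<equiv> torsion r"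
  shows "vderiv (vderiv (vderiv (vderiv r))) s =
      (- 3 * k s * deriv k s) *\<^sub>R unit_tangent r s
      + (deriv (deriv k) s - k s ^ 3 - k s * (\<tau> s)\<^sup>2) *\<^sub>R principal_normal r s
      + (2 * deriv k s * \<tau> s + k s * deriv \<tau> s) *\<^sub>R binormal r s"
proof -
  define t n b where "t = unit_tangent r" and "n = principal_normal r" and "b = binormal r"
  note fr = unit_speed_frenet_equations[OF r unit nz, folded k_def \<tau>_def t_def n_def b_def]
  have r1: "vderiv r = t"
    by (simp add: t_def unit_speed_tangent unit)
  have r2: "vderiv (vderiv r) = (\<lambda>s. k s *\<^sub>R n s)"
    unfolding r1 using vderiv_eqI[OF fr(7)] by (simp add: fun_eq_iff)
  have r3: "vderiv (vderiv (vderiv r))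
      = (\<lambda>s. k s *\<^sub>R (\<tau> s *\<^sub>R b s - k s *\<^sub>R t s) + deriv k s *\<^sub>R n s)"
    unfolding r2 using vderiv_eqI[OF has_vector_derivative_scaleR[OF fr(10) fr(8)]]
    by (simp add: fun_eq_iff)
  have "((\<lambda>s. k s *\<^sub>R (\<tau> s *\<^sub>R b s - k s *\<^sub>R t s) + deriv k s *\<^sub>R n s) has_vector_derivative
      (k s *\<^sub>R ((\<tau> s *\<^sub>R (- (\<tau> s *\<^sub>R n s)) + deriv \<tau> s *\<^sub>R b s)
                 - (k s *\<^sub>R (k s *\<^sub>R n s) + deriv k s *\<^sub>R t s))
        + deriv k s *\<^sub>R (\<tau> s *\<^sub>R b s - k s *\<^sub>R t s))
      + (deriv k s *\<^sub>R (\<tau> s *\<^sub>R b s - k s *\<^sub>R t s) + deriv (deriv k) s *\<^sub>R n s)) (at s)"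
    by (intro has_vector_derivative_add has_vector_derivative_diff has_vector_derivative_scaleR fr)
  from vderiv_eqI[OF this] show ?thesis
    unfolding r3 t_def[symmetric] n_def[symmetric] b_def[symmetric]
    by (simp add: vec_eq_iff algebra_simps power2_eq_square power3_eq_cube)
qed

section \<open>Integration by parts over a period\<close>

theorem theorem3p1:
  fixes L :: real
    and r z :: "real \<Rightarrow> real^3"
    and zt z1 z2 k \<tau> :: "real \<Rightarrow> real"
  assumes "L > 0"
    and "C_k 4 r"
    and "\<And>s. r (s + L) = r s"
    and "inj_on r {0..<L}"
    and "\<And>s. norm (vderiv r s) = 1"
    and "k = curvature r"
    and "\<And>s. k s \<noteq> 0"
    and "\<tau> = torsion r"
    and "C_k 4 z"
    and "\<And>s. z (s + L) = z s"
    and "infinitesimal_bending_field r z"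
    and "\<And>s. z s = zt s *\<^sub>R unit_tangent r s + z1 s *\<^sub>R principal_normal r s
              + z2 s *\<^sub>R binormal r s"
  shows "((\<lambda>\<epsilon>. willmore_energy L (\<lambda>s. r s + \<epsilon> *\<^sub>R z s)) has_real_derivative
           integral {0..L} (\<lambda>s.
             (deriv (deriv k) s + 1/2 * k s ^ 3 - k s * (\<tau> s)\<^sup>2) * z1 s
             + (2 * deriv k s * \<tau> s + k s * deriv \<tau> s) * z2 s)) (at 0)"
proof -
  define t n b where "t = unit_tangent r" and "n = principal_normal r" and "b = binormal r"
  let ?r2 = "vderiv (vderiv r)" and ?r3 = "vderiv (vderiv (vderiv r))"
  let ?r4 = "vderiv (vderiv (vderiv (vderiv r)))"
  let ?z1 = "vderiv z" and ?z2 = "vderiv (vderiv z)"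
  define I where "I s = (deriv (deriv k) s + 1/2 * k s ^ 3 - k s * (\<tau> s)\<^sup>2) * z1 s
             + (2 * deriv k s * \<tau> s + k s * deriv \<tau> s) * z2 s" for s
  note dr = C_k_has_vector_derivatives[OF assms(2), simplified]
    and dz = C_k_has_vector_derivatives[OF assms(9), simplified]
  have nz: "curvature r s \<noteq> 0" for s
    using assms(6,7) by simp
  note fr = unit_speed_frenet_equations[OF assms(2,5) nz, folded assms(6,8) t_def n_def b_def]
  note r4 = fourth_derivative_frenet[OF assms(2,5) nz, folded assms(6,8) t_def n_def b_def]
  note z = assms(12)[folded t_def n_def b_def]
  have t: "vderiv r = t"
    by (simp add: t_def unit_speed_tangent assms(5))
  have zt: "zt = (\<lambda>s. z s \<bullet> t s)" and z1: "z1 = (\<lambda>s. z s \<bullet> n s)" and z2: "z2 = (\<lambda>s. z s \<bullet> b s)"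
    using fr(1-6) fr(3-5)[unfolded inner_commute[of "t _"] inner_commute[of "n _" "b _"]]
    by (auto simp: z inner_add_left)
  have zt': "(zt has_real_derivative k s * z1 s) (at s)" for s
    using has_real_derivative_inner[OF dz(1) fr(7)] assms(11)
    by (simp add: zt z1 infinitesimal_bending_field_def t inner_commute)
  have r4z: "?r4 s \<bullet> z s = I s - 3/2 * k s ^ 3 * z1 s - 3 * k s * deriv k s * zt s" for s
    unfolding r4 I_def by (simp add: zt z1 z2 inner_add_left inner_commute algebra_simps)

  \<comment> \<open>The first two terms are the boundary terms of the integrations by parts from \<open>r'' \<bullet> z''\<close> to
    \<open>r'''' \<bullet> z\<close>; the last one is the boundary term that removes the tangential component.\<close>
  define G where "G s = ?r2 s \<bullet> ?z1 s - ?r3 s \<bullet> z s - 3/2 * ((k s)\<^sup>2 * zt s)" for s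
  have G': "(G has_real_derivative ?r2 s \<bullet> ?z2 s - I s) (at s)" for s
  proof -
    have "(G has_real_derivative (?r2 s \<bullet> ?z2 s + ?r3 s \<bullet> ?z1 s) - (?r3 s \<bullet> ?z1 s + ?r4 s \<bullet> z s)
        - 3/2 * ((2 * k s * deriv k s) * zt s + k s * z1 s * (k s)\<^sup>2)) (at s)"
      unfolding G_def
      by (intro DERIV_diff DERIV_cmult DERIV_mult has_real_derivative_inner dr dz zt')
         (auto intro!: derivative_eq_intros fr(10))
    then show ?thesis
      by (rule DERIV_cong) (simp add: r4z power2_eq_square power3_eq_cube field_simps)
  qed
  have "G (s + L) = G s" for s
  proof -
    note p = vderiv_periodic[where L = L]
    have r1p: "vderiv r (s + L) = vderiv r s" for s
      by (rule p[OF dr(1) assms(3)])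
    have r2p: "?r2 (s + L) = ?r2 s" for s
      by (rule p[OF dr(2) r1p])
    have r3p: "?r3 (s + L) = ?r3 s" for s
      by (rule p[OF dr(3) r2p])
    have z1p: "?z1 (s + L) = ?z1 s" for s
      by (rule p[OF dz(1) assms(10)])
    have "k (s + L) = k s"
      by (simp add: assms(6) unit_speed_curvature assms(5) r2p)
    moreover have "zt (s + L) = zt s"
      by (simp add: zt assms(10) r1p flip: t)
    ultimately show ?thesis
      by (simp add: G_def r2p r3p z1p assms(10))
  qed
  from this[of 0] have "((\<lambda>s. ?r2 s \<bullet> ?z2 s - I s) has_integral 0) {0..L}"
    using fundamental_theorem_of_calculus[of 0 L G "\<lambda>s. ?r2 s \<bullet> ?z2 s - I s"] assms(1) G'
    by (auto simp: has_real_derivative_iff_has_vector_derivative[symmetric]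
        intro: has_field_derivative_at_within)
  \<comment> \<open>Integrability of \<open>I\<close> follows from that of \<open>r'' \<bullet> z''\<close> and of the difference.\<close>
  moreover have "(\<lambda>s. ?r2 s \<bullet> ?z2 s) integrable_on {0..L}"
    using C_k_continuous[OF assms(2), of 2] C_k_continuous[OF assms(9), of 2]
    by (intro integrable_continuous_real continuous_intros) (simp_all add: eval_nat_numeral)
  ultimately have "(I has_integral integral {0..L} (\<lambda>s. ?r2 s \<bullet> ?z2 s)) {0..L}"
    using has_integral_diff[OF integrable_integral] by fastforce
  then have "integral {0..L} (\<lambda>s. ?r2 s \<bullet> ?z2 s) = integral {0..L} I"
    by (simp add: integral_unique)
  then show ?thesis
    using first_variation_second_derivatives
        [OF C_k_mono[OF assms(2)] C_k_mono[OF assms(9)] assms(5,11), of L]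
    by (simp add: I_def[abs_def])
qed

end
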